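(* Let $(M,J,g,G)$ be an almost anti-Hermitian manifold, let $\nabla$ be a $J$-invariant torsion-free linear connection on $M$, and let $\nabla^{\ast}$ denote the $g$-conjugate connection of $\nabla$. Then $(\nabla,G)$ is a statistical structure if and only if $(\nabla^{\ast},G)$ is a statistical structure.
   Context: An almost anti-Hermitian manifold $(M,J,g,G)$ is a smooth $2n$-dimensional manifold $M$ with an almost complex structure $J$ ($J^{2}=-\mathrm{id}$), a pseudo-Riemannian metric $g$ of neutral signature $(n,n)$ satisfying $g(JX,JY)=-g(X,Y)$, equivalently $g(JX,Y)=g(X,JY)$, for all vector fields $X,Y$, and the twin metric $G(X,Y)=g(JX,Y)$ (which is again a pseudo-Riemannian metric). A linear connection is a connection on $TM$. It is $J$-invariant if $\nabla_X(JY)=J\nabla_X Y$ for all vector fields $X,Y$. The $g$-conjugate $\nabla^{\ast}$ of $\nabla$ is the linear connection determined by $Zg(X,Y)=g(\nabla_Z X,Y)+g(X,\nabla^{\ast}_Z Y)$ for all vector fields $X,Y,Z$. For a linear connection $D$ and a pseudo-Riemannian metric $h$, $(D,h)$ is a Codazzi pair if $(D_Z h)(X,Y)=(D_X h)(Z,Y)$ for all vector fields $X,Y,Z$; $(D,h)$ is a statistical structure if $D$ is torsion-free and $(D,h)$ is a Codazzi pair. *)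

theory Defs
  imports "HOL-Analysis.Analysis" "HOL-Library.Function_Algebras"
begin

section \<open>Smooth maps between open sets of normed spaces\<close>

text \<open>Only meant for open \<open>S\<close>. For a finite-dimensional domain, \<open>C_on k S f\<close> is the usual class
  $C^k$: all iterated directional derivatives up to order \<open>k\<close> exist and are continuous.\<close>

primrec C_on :: "nat \<Rightarrow> 'e::real_normed_vector set \<Rightarrow> ('e \<Rightarrow> 'f::real_normed_vector) \<Rightarrow> bool" where
  "C_on 0 S f \<longleftrightarrow> continuous_on S f"
| "C_on (Suc k) S f \<longleftrightarrow> (\<forall>x\<in>S. f differentiable (at x)) \<and>
     (\<forall>v. C_on k S (\<lambda>x. frechet_derivative f (at x) v))"

definition smooth_on :: "'e::real_normed_vector set \<Rightarrow> ('e \<Rightarrow> 'f::real_normed_vector) \<Rightarrow> bool" where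
  "smooth_on S f \<longleftrightarrow> (\<forall>k. C_on k S f)"

section \<open>Smooth manifolds\<close>

text \<open>The manifold is the whole type \<open>'a\<close>, whose sort makes it Hausdorff and second countable. It is
  modelled on the Euclidean space \<open>'e\<close>, and its smooth structure is the one generated by an atlas
  \<open>A\<close>, which need not be maximal. A chart is a pair of its domain and its coordinate map; the values
  of the coordinate map outside the domain are irrelevant.\<close>

type_synonym ('a, 'e) chart = "'a set \<times> ('a \<Rightarrow> 'e)"

abbreviation chart_dom :: "('a, 'e) chart \<Rightarrow> 'a set" where
  "chart_dom \<equiv> fst"

abbreviation chart_map :: "('a, 'e) chart \<Rightarrow> 'a \<Rightarrow> 'e" where
  "chart_map \<equiv> snd"

abbreviation chart_im :: "('a, 'e) chart \<Rightarrow> 'e set" where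
  "chart_im c \<equiv> chart_map c ` chart_dom c"

definition local_rep :: "('a, 'e) chart \<Rightarrow> ('a \<Rightarrow> 'b) \<Rightarrow> 'e \<Rightarrow> 'b" where
  "local_rep c f = f \<circ> inv_into (chart_dom c) (chart_map c)"

definition is_chart :: "('a::topological_space, 'e::euclidean_space) chart \<Rightarrow> bool" where
  "is_chart c \<longleftrightarrow> open (chart_dom c) \<and> open (chart_im c) \<and>
     homeomorphism (chart_dom c) (chart_im c) (chart_map c) (inv_into (chart_dom c) (chart_map c))"

definition smooth_atlas ::
    "('a::{t2_space,second_countable_topology}, 'e::euclidean_space) chart set \<Rightarrow> bool" where
  "smooth_atlas A \<longleftrightarrow>
     (\<forall>c\<in>A. is_chart c) \<and>
     (\<Union>c\<in>A. chart_dom c) = UNIV \<and>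
     (\<forall>c\<in>A. \<forall>d\<in>A.
        smooth_on (chart_map c ` (chart_dom c \<inter> chart_dom d)) (local_rep c (chart_map d)))"

definition charts_at :: "('a, 'e) chart set \<Rightarrow> 'a \<Rightarrow> ('a, 'e) chart set" where
  "charts_at A p = {c\<in>A. p \<in> chart_dom c}"

definition smooth_fun ::
    "('a, 'e::euclidean_space) chart set \<Rightarrow> ('a \<Rightarrow> 'b::real_normed_vector) \<Rightarrow> bool" where
  "smooth_fun A f \<longleftrightarrow> (\<forall>c\<in>A. smooth_on (chart_im c) (local_rep c f))"

section \<open>Tangent vectors and vector fields\<close>

text \<open>A tangent vector at \<open>p\<close> is the family of its coordinate representatives in the charts around
  \<open>p\<close>; these are related by the derivatives of the transition maps. The value \<open>0\<close> at all other
  indices makes equality of tangent vectors coincide with equality of functions. Addition,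
  subtraction, negation and zero of tangent vectors and of vector fields are the pointwise ones.\<close>

type_synonym ('a, 'e) tvec = "('a, 'e) chart \<Rightarrow> 'e"

type_synonym ('a, 'e) vfield = "'a \<Rightarrow> ('a, 'e) tvec"

definition tangent_space ::
    "('a, 'e::euclidean_space) chart set \<Rightarrow> 'a \<Rightarrow> ('a, 'e) tvec set" where
  "tangent_space A p = {v.
     (\<forall>c. c \<notin> charts_at A p \<longrightarrow> v c = 0) \<and>
     (\<forall>c\<in>charts_at A p. \<forall>d\<in>charts_at A p.
        v d = frechet_derivative (local_rep c (chart_map d)) (at (chart_map c p)) (v c))}"

definition tscale :: "real \<Rightarrow> ('a, 'e::euclidean_space) tvec \<Rightarrow> ('a, 'e) tvec" where
  "tscale a v = (\<lambda>c. a *\<^sub>R v c)"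

definition vscale :: "('a \<Rightarrow> real) \<Rightarrow> ('a, 'e::euclidean_space) vfield \<Rightarrow> ('a, 'e) vfield" where
  "vscale f X = (\<lambda>p. tscale (f p) (X p))"

definition smooth_vfields ::
    "('a, 'e::euclidean_space) chart set \<Rightarrow> ('a, 'e) vfield set" where
  "smooth_vfields A = {X.
     (\<forall>p. X p \<in> tangent_space A p) \<and>
     (\<forall>c\<in>A. smooth_on (chart_im c) (local_rep c (\<lambda>p. X p c)))}"

text \<open>The derivative \<open>X f\<close> of a function along a vector field, computed in any chart around the
  point; by the chain rule it does not depend on the chart.\<close>

definition vderiv ::
    "('a, 'e::euclidean_space) chart set \<Rightarrow> ('a, 'e) vfield \<Rightarrow> ('a \<Rightarrow> real) \<Rightarrow> 'a \<Rightarrow> real" where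
  "vderiv A X f p =
     (let c = (SOME c. c \<in> charts_at A p)
      in frechet_derivative (local_rep c f) (at (chart_map c p)) (X p c))"

text \<open>In coordinates, $[X,Y]^k = X^i \partial_i Y^k - Y^i \partial_i X^k$.\<close>

definition lie_bracket ::
    "('a, 'e::euclidean_space) chart set \<Rightarrow> ('a, 'e) vfield \<Rightarrow> ('a, 'e) vfield \<Rightarrow> ('a, 'e) vfield" where
  "lie_bracket A X Y = (\<lambda>p c.
     if c \<in> charts_at A p
     then frechet_derivative (local_rep c (\<lambda>q. Y q c)) (at (chart_map c p)) (X p c)
        - frechet_derivative (local_rep c (\<lambda>q. X q c)) (at (chart_map c p)) (Y p c)
     else 0)"

section \<open>Tensor fields\<close>

text \<open>Tensor fields are families of (multi)linear maps on the tangent spaces; only their values on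
  tangent vectors matter. Smoothness is tested on smooth vector fields.\<close>

type_synonym ('a, 'e) endo_field = "'a \<Rightarrow> ('a, 'e) tvec \<Rightarrow> ('a, 'e) tvec"

type_synonym ('a, 'e) form_field = "'a \<Rightarrow> ('a, 'e) tvec \<Rightarrow> ('a, 'e) tvec \<Rightarrow> real"

definition endo_app :: "('a, 'e) endo_field \<Rightarrow> ('a, 'e) vfield \<Rightarrow> ('a, 'e) vfield" where
  "endo_app J X = (\<lambda>p. J p (X p))"

definition form_app ::
    "('a, 'e) form_field \<Rightarrow> ('a, 'e) vfield \<Rightarrow> ('a, 'e) vfield \<Rightarrow> 'a \<Rightarrow> real" where
  "form_app h X Y = (\<lambda>p. h p (X p) (Y p))"

definition smooth_endo_field ::
    "('a, 'e::euclidean_space) chart set \<Rightarrow> ('a, 'e) endo_field \<Rightarrow> bool" where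
  "smooth_endo_field A J \<longleftrightarrow>
     (\<forall>p. \<forall>v\<in>tangent_space A p. J p v \<in> tangent_space A p) \<and>
     (\<forall>p. \<forall>v\<in>tangent_space A p. \<forall>w\<in>tangent_space A p. J p (v + w) = J p v + J p w) \<and>
     (\<forall>p a. \<forall>v\<in>tangent_space A p. J p (tscale a v) = tscale a (J p v)) \<and>
     (\<forall>X\<in>smooth_vfields A. endo_app J X \<in> smooth_vfields A)"

definition almost_complex_structure ::
    "('a, 'e::euclidean_space) chart set \<Rightarrow> ('a, 'e) endo_field \<Rightarrow> bool" where
  "almost_complex_structure A J \<longleftrightarrow> smooth_endo_field A J \<and>
     (\<forall>p. \<forall>v\<in>tangent_space A p. J p (J p v) = - v)"

definition smooth_symmetric_form_field ::
    "('a, 'e::euclidean_space) chart set \<Rightarrow> ('a, 'e) form_field \<Rightarrow> bool" where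
  "smooth_symmetric_form_field A h \<longleftrightarrow>
     (\<forall>p. \<forall>u\<in>tangent_space A p. \<forall>v\<in>tangent_space A p. \<forall>w\<in>tangent_space A p.
        h p (u + v) w = h p u w + h p v w) \<and>
     (\<forall>p a. \<forall>v\<in>tangent_space A p. \<forall>w\<in>tangent_space A p. h p (tscale a v) w = a * h p v w) \<and>
     (\<forall>p. \<forall>v\<in>tangent_space A p. \<forall>w\<in>tangent_space A p. h p v w = h p w v) \<and>
     (\<forall>X\<in>smooth_vfields A. \<forall>Y\<in>smooth_vfields A. smooth_fun A (form_app h X Y))"

text \<open>The family \<open>b\<close> is a pseudo-orthonormal basis of \<open>V\<close> with \<open>r\<close> vectors of square \<open>1\<close> and \<open>s\<close>
  vectors of square \<open>-1\<close>. Its linear independence is a consequence of the orthogonality relations.\<close>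

definition has_signature ::
    "('a, 'e::euclidean_space) tvec set \<Rightarrow> (('a, 'e) tvec \<Rightarrow> ('a, 'e) tvec \<Rightarrow> real) \<Rightarrow>
       nat \<Rightarrow> nat \<Rightarrow> bool" where
  "has_signature V h r s \<longleftrightarrow> (\<exists>b::nat \<Rightarrow> ('a, 'e) tvec.
     (\<forall>i<r+s. b i \<in> V) \<and>
     (\<forall>v\<in>V. \<exists>a. v = (\<Sum>i<r+s. tscale (a i) (b i))) \<and>
     (\<forall>i<r+s. \<forall>j<r+s. h (b i) (b j) = (if i \<noteq> j then 0 else if i < r then 1 else - 1)))"

definition pseudo_riemannian_metric ::
    "('a, 'e::euclidean_space) chart set \<Rightarrow> nat \<Rightarrow> nat \<Rightarrow> ('a, 'e) form_field \<Rightarrow> bool" where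
  "pseudo_riemannian_metric A r s h \<longleftrightarrow> smooth_symmetric_form_field A h \<and>
     (\<forall>p. \<forall>v\<in>tangent_space A p. (\<forall>w\<in>tangent_space A p. h p v w = 0) \<longrightarrow> v = 0) \<and>
     (\<forall>p. has_signature (tangent_space A p) (h p) r s)"

definition almost_anti_hermitian ::
    "('a::{t2_space,second_countable_topology}, 'e::euclidean_space) chart set \<Rightarrow> nat \<Rightarrow>
       ('a, 'e) endo_field \<Rightarrow> ('a, 'e) form_field \<Rightarrow> ('a, 'e) form_field \<Rightarrow> bool" where
  "almost_anti_hermitian A n J g G \<longleftrightarrow>
     smooth_atlas A \<and> DIM('e) = 2 * n \<and>
     almost_complex_structure A J \<and>
     pseudo_riemannian_metric A n n g \<and>
     (\<forall>X\<in>smooth_vfields A. \<forall>Y\<in>smooth_vfields A.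
        form_app g (endo_app J X) (endo_app J Y) = - form_app g X Y) \<and>
     (\<forall>p. \<forall>v\<in>tangent_space A p. \<forall>w\<in>tangent_space A p. G p v w = g p (J p v) w)"

section \<open>Linear connections\<close>

text \<open>\<open>D X Y\<close> is the covariant derivative $D_X Y$.\<close>

type_synonym ('a, 'e) connection = "('a, 'e) vfield \<Rightarrow> ('a, 'e) vfield \<Rightarrow> ('a, 'e) vfield"

definition linear_connection ::
    "('a, 'e::euclidean_space) chart set \<Rightarrow> ('a, 'e) connection \<Rightarrow> bool" where
  "linear_connection A D \<longleftrightarrow>
     (\<forall>X\<in>smooth_vfields A. \<forall>Y\<in>smooth_vfields A. D X Y \<in> smooth_vfields A) \<and>
     (\<forall>X\<in>smooth_vfields A. \<forall>X'\<in>smooth_vfields A. \<forall>Y\<in>smooth_vfields A.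
        D (X + X') Y = D X Y + D X' Y) \<and>
     (\<forall>f. \<forall>X\<in>smooth_vfields A. \<forall>Y\<in>smooth_vfields A. smooth_fun A f \<longrightarrow>
        D (vscale f X) Y = vscale f (D X Y)) \<and>
     (\<forall>X\<in>smooth_vfields A. \<forall>Y\<in>smooth_vfields A. \<forall>Y'\<in>smooth_vfields A.
        D X (Y + Y') = D X Y + D X Y') \<and>
     (\<forall>f. \<forall>X\<in>smooth_vfields A. \<forall>Y\<in>smooth_vfields A. smooth_fun A f \<longrightarrow>
        D X (vscale f Y) = vscale (vderiv A X f) Y + vscale f (D X Y))"

definition J_invariant ::
    "('a, 'e::euclidean_space) chart set \<Rightarrow> ('a, 'e) endo_field \<Rightarrow> ('a, 'e) connection \<Rightarrow> bool" where
  "J_invariant A J D \<longleftrightarrow>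
     (\<forall>X\<in>smooth_vfields A. \<forall>Y\<in>smooth_vfields A. D X (endo_app J Y) = endo_app J (D X Y))"

definition torsion_free ::
    "('a, 'e::euclidean_space) chart set \<Rightarrow> ('a, 'e) connection \<Rightarrow> bool" where
  "torsion_free A D \<longleftrightarrow>
     (\<forall>X\<in>smooth_vfields A. \<forall>Y\<in>smooth_vfields A. D X Y - D Y X = lie_bracket A X Y)"

definition conjugate_connection ::
    "('a, 'e::euclidean_space) chart set \<Rightarrow> ('a, 'e) form_field \<Rightarrow>
       ('a, 'e) connection \<Rightarrow> ('a, 'e) connection \<Rightarrow> bool" where
  "conjugate_connection A g D D' \<longleftrightarrow> linear_connection A D' \<and>
     (\<forall>X\<in>smooth_vfields A. \<forall>Y\<in>smooth_vfields A. \<forall>Z\<in>smooth_vfields A.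
        vderiv A Z (form_app g X Y) = form_app g (D Z X) Y + form_app g X (D' Z Y))"

text \<open>\<open>cov_deriv_form A D h Z X Y\<close> is $(D_Z h)(X,Y)$.\<close>

definition cov_deriv_form ::
    "('a, 'e::euclidean_space) chart set \<Rightarrow> ('a, 'e) connection \<Rightarrow> ('a, 'e) form_field \<Rightarrow>
       ('a, 'e) vfield \<Rightarrow> ('a, 'e) vfield \<Rightarrow> ('a, 'e) vfield \<Rightarrow> 'a \<Rightarrow> real" where
  "cov_deriv_form A D h Z X Y =
     vderiv A Z (form_app h X Y) - form_app h (D Z X) Y - form_app h X (D Z Y)"

definition codazzi_pair ::
    "('a, 'e::euclidean_space) chart set \<Rightarrow> ('a, 'e) connection \<Rightarrow> ('a, 'e) form_field \<Rightarrow> bool" where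
  "codazzi_pair A D h \<longleftrightarrow>
     (\<forall>X\<in>smooth_vfields A. \<forall>Y\<in>smooth_vfields A. \<forall>Z\<in>smooth_vfields A.
        cov_deriv_form A D h Z X Y = cov_deriv_form A D h X Z Y)"

text \<open>For a linear connection \<open>D\<close> and a pseudo-Riemannian metric \<open>h\<close>.\<close>

definition statistical_structure ::
    "('a, 'e::euclidean_space) chart set \<Rightarrow> ('a, 'e) connection \<Rightarrow> ('a, 'e) form_field \<Rightarrow> bool" where
  "statistical_structure A D h \<longleftrightarrow> torsion_free A D \<and> codazzi_pair A D h"

end

theory Submission
  imports Defs "HOL-Computational_Algebra.Polynomial"
begin

text \<open>Write \<open>D\<close> for the given connection, \<open>D'\<close> for its \<open>g\<close>-conjugate and \<open>K = D' - D\<close>. Replacing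
  \<open>X\<close> by \<open>J X\<close> in the defining identity of \<open>D'\<close> and moving \<open>J\<close> past \<open>D\<close> shows that \<open>D'\<close> is also
  the \<open>G\<close>-conjugate of \<open>D\<close> (\<open>twin_conjugate\<close>). From there on \<open>J\<close> and \<open>g\<close> no longer appear: what
  remains is a fact about a nondegenerate symmetric form and a torsion-free connection with its conjugate
  (\<open>statistical_structure_conjugate_iff\<close>).

  Conjugacy says $(D_Z G)(X,Y) = G(X, K_Z Y)$, while directly $(D'_Z G)(X,Y) = - G(K_Z X, Y)$.
  Since $D_Z G$ is symmetric, $D' G = - D G$ (\<open>cov_deriv_form_conjugate\<close>), so the Codazzi condition
  holds for both connections or for neither. If it holds, then $D G$ is totally symmetric, hence
  $G(W, K_X Y) = G(W, K_Y X)$ for all fields \<open>W\<close>; nondegeneracy gives $K_X Y = K_Y X$, that is, \<open>D\<close>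
  and \<open>D'\<close> have the same torsion (\<open>codazzi_imp_conjugate_torsion_free\<close>).

  The identities concern smooth vector fields on the whole manifold, whereas nondegeneracy concerns
  single tangent spaces. Cancelling \<open>G(W, _)\<close>, as well as reading the anti-Hermitian condition at
  a point, therefore requires that every tangent vector be the value of a global smooth vector field
  (\<open>tangent_vector_extends\<close>). This is the analytic part of the proof: a bump function cuts off a
  constant field in a chart, and extending by zero is smooth because compact subsets of a Hausdorff
  space are closed.\<close>

section \<open>Calculus of functions of class $C^k$\<close>

text \<open>On an open set the derivative at a point depends only on the values nearby, so the recursion in
  \<open>C_on\<close> sees nothing else.\<close>
lemma C_on_cong:
  assumes "open S" "C_on k S f" "\<And>x. x \<in> S \<Longrightarrow> f x = g x"
  shows "C_on k S g"
  using assms(2,3)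
proof (induction k arbitrary: f g)
  case 0
  then show ?case by (metis C_on.simps(1) continuous_on_cong)
next
  case (Suc k)
  have der: "(g has_derivative frechet_derivative f (at x)) (at x)" if "x \<in> S" for x
    using Suc.prems \<open>open S\<close> that
    by (metis C_on.simps(2) frechet_derivative_works has_derivative_transform_within_open)
  then have "C_on k S (\<lambda>x. frechet_derivative g (at x) v)" for v
    using Suc.prems Suc.IH[of "\<lambda>x. frechet_derivative f (at x) v"]
    by (simp add: frechet_derivative_at[OF der, symmetric])
  with der show ?case
    by (auto simp: differentiable_def)
qed

text \<open>Any derivative found by the differentiation rules may replace \<open>frechet_derivative\<close>; the
  arithmetic rules and the composition rule below are inductions on \<open>k\<close> that use this rule.\<close>
lemma C_on_SucI:
  assumes "open S" "\<And>x. x \<in> S \<Longrightarrow> (f has_derivative f' x) (at x)" "\<And>v. C_on k S (\<lambda>x. f' x v)"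
  shows "C_on (Suc k) S f"
proof -
  have "C_on k S (\<lambda>x. frechet_derivative f (at x) v)" for v
    by (rule C_on_cong[OF assms(1) assms(3)[of v]])
      (simp add: frechet_derivative_at[OF assms(2), symmetric])
  then show ?thesis
    using assms(2) by (auto simp: differentiable_def)
qed

lemma C_on_Suc_derivative:
  "C_on (Suc k) S f \<Longrightarrow> x \<in> S \<Longrightarrow> (f has_derivative frechet_derivative f (at x)) (at x)"
  by (simp add: frechet_derivative_works)

lemma C_on_subset: "C_on k S f \<Longrightarrow> T \<subseteq> S \<Longrightarrow> C_on k T f"
  by (induction k arbitrary: f) (auto intro: continuous_on_subset)

lemma C_on_SucD: "C_on (Suc k) S f \<Longrightarrow> C_on k S f"
proof (induction k arbitrary: f)
  case 0
  then show ?case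
    by (auto simp: intro!: continuous_at_imp_continuous_on differentiable_imp_continuous_within)
next
  case (Suc k)
  then show ?case by (auto simp del: C_on.simps simp add: C_on.simps(2)[of _ S f])
qed

lemma C_on_Un:
  assumes "open S" "open T" "C_on k S f" "C_on k T f"
  shows "C_on k (S \<union> T) f"
  using assms(3,4) by (induction k arbitrary: f) (auto intro: continuous_on_open_Un assms(1,2))

lemma C_on_const: "C_on k S (\<lambda>_. c)"
  by (induction k arbitrary: c) auto

lemma C_on_linear:
  assumes "open S" "bounded_linear h" "C_on k S f"
  shows "C_on k S (\<lambda>x. h (f x))"
  using assms(3)
proof (induction k arbitrary: f)
  case 0
  then show ?case by (auto intro!: bounded_linear.continuous_on[OF assms(2)])
next
  case (Suc k)
  show ?case
  proof (rule C_on_SucI[OF assms(1)])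
    show "((\<lambda>x. h (f x)) has_derivative (\<lambda>v. h (frechet_derivative f (at x) v))) (at x)" if "x \<in> S" for x
      by (rule bounded_linear.has_derivative[OF assms(2) C_on_Suc_derivative[OF Suc.prems that]])
  qed (use Suc in auto)
qed

lemma C_on_id: "open S \<Longrightarrow> C_on k S (\<lambda>x. x)"
  by (cases k) (auto intro!: C_on_SucI[where f' = "\<lambda>_ v. v"] C_on_const simp del: C_on.simps(2))

lemma C_on_add:
  assumes "open S" "C_on k S f" "C_on k S g"
  shows "C_on k S (\<lambda>x. f x + g x)"
  using assms(2,3)
proof (induction k arbitrary: f g)
  case 0
  then show ?case by (auto intro!: continuous_on_add)
next
  case (Suc k)
  show ?case
  proof (rule C_on_SucI[OF assms(1)])
    show "((\<lambda>x. f x + g x) has_derivative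
        (\<lambda>v. frechet_derivative f (at x) v + frechet_derivative g (at x) v)) (at x)" if "x \<in> S" for x
      by (intro has_derivative_add C_on_Suc_derivative[OF Suc.prems(1) that]
          C_on_Suc_derivative[OF Suc.prems(2) that])
  qed (use Suc in auto)
qed

lemma C_on_sum:
  assumes "open S" "\<And>i. i \<in> I \<Longrightarrow> C_on k S (f i)"
  shows "C_on k S (\<lambda>x. \<Sum>i\<in>I. f i x)"
  using assms(2) by (induction I rule: infinite_finite_induct) (auto intro: C_on_const C_on_add assms(1))

lemma C_on_bilinear:
  assumes "open S" "bounded_bilinear bil" "C_on k S f" "C_on k S g"
  shows "C_on k S (\<lambda>x. bil (f x) (g x))"
  using assms(3,4)
proof (induction k arbitrary: f g)
  case 0
  then show ?case by (auto intro!: bounded_bilinear.continuous_on[OF assms(2)])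
next
  case (Suc k)
  show ?case
  proof (rule C_on_SucI[OF assms(1)])
    show "((\<lambda>x. bil (f x) (g x)) has_derivative
        (\<lambda>v. bil (f x) (frechet_derivative g (at x) v) + bil (frechet_derivative f (at x) v) (g x))) (at x)"
      if "x \<in> S" for x
      by (rule bounded_bilinear.FDERIV[OF assms(2) C_on_Suc_derivative[OF Suc.prems(1) that]
          C_on_Suc_derivative[OF Suc.prems(2) that]])
    show "C_on k S (\<lambda>x. bil (f x) (frechet_derivative g (at x) v) +
        bil (frechet_derivative f (at x) v) (g x))" for v
      using Suc.prems
      by (intro C_on_add[OF assms(1)] Suc.IH C_on_SucD[OF Suc.prems(1)] C_on_SucD[OF Suc.prems(2)]) auto
  qed
qed

lemma linear_eq_sum_Basis:
  assumes "linear (h :: 'e::euclidean_space \<Rightarrow> 'f::real_vector)"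
  shows "h u = (\<Sum>b\<in>Basis. (u \<bullet> b) *\<^sub>R h b)"
proof -
  have "h u = h (\<Sum>b\<in>Basis. (u \<bullet> b) *\<^sub>R b)" by (simp add: euclidean_representation)
  also have "\<dots> = (\<Sum>b\<in>Basis. (u \<bullet> b) *\<^sub>R h b)"
    by (simp add: linear_sum[OF assms] linear_scale[OF assms])
  finally show ?thesis .
qed

text \<open>\<open>C_on\<close> controls a derivative one fixed direction at a time. Expanding the direction \<open>u x\<close> in a basis
  allows it to vary with the point, as it does in the chain rule and in the transformation law of
  vector fields.\<close>
lemma C_on_linear_family_apply:
  fixes u :: "'d::real_normed_vector \<Rightarrow> 'e::euclidean_space"
  assumes "open S" "\<And>x. x \<in> S \<Longrightarrow> linear (h x)" "\<And>b. C_on k S (\<lambda>x. h x b)" "C_on k S u"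
  shows "C_on k S (\<lambda>x. h x (u x))"
proof (rule C_on_cong[OF assms(1)])
  show "C_on k S (\<lambda>x. \<Sum>b\<in>Basis. (u x \<bullet> b) *\<^sub>R h x b)"
    by (intro C_on_sum[OF assms(1)] C_on_bilinear[OF assms(1) bounded_bilinear_scaleR] assms(3)
        C_on_linear[OF assms(1) bounded_linear_inner_left assms(4)])
  show "(\<Sum>b\<in>Basis. (u x \<bullet> b) *\<^sub>R h x b) = h x (u x)" if "x \<in> S" for x
    by (rule linear_eq_sum_Basis[OF assms(2)[OF that], symmetric])
qed

text \<open>By the chain rule the derivative of the composition is the derivative of \<open>f\<close>, evaluated at \<open>g x\<close> and
  applied to the derivative of \<open>g\<close>. For each fixed direction the induction hypothesis covers the
  first; only \<open>f\<close> changes in the induction.\<close>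
lemma C_on_compose:
  fixes g :: "'d::real_normed_vector \<Rightarrow> 'e::euclidean_space"
  assumes "open S" "open T" "g ` S \<subseteq> T" "C_on k T f" "C_on k S g"
  shows "C_on k S (\<lambda>x. f (g x))"
  using assms(4,5)
proof (induction k arbitrary: f)
  case 0
  then show ?case using assms(3) by (auto intro: continuous_on_compose2)
next
  case (Suc k)
  have f: "(f has_derivative frechet_derivative f (at (g x))) (at (g x))" if "x \<in> S" for x
    by (rule C_on_Suc_derivative[OF Suc.prems(1)]) (use that assms(3) in auto)
  show ?case
  proof (rule C_on_SucI[OF assms(1)])
    show "((\<lambda>x. f (g x)) has_derivative
        (\<lambda>v. frechet_derivative f (at (g x)) (frechet_derivative g (at x) v))) (at x)" if "x \<in> S" for x
      using diff_chain_at[OF C_on_Suc_derivative[OF Suc.prems(2) that] f[OF that]] by (simp add: o_def)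
    show "C_on k S (\<lambda>x. frechet_derivative f (at (g x)) (frechet_derivative g (at x) v))" for v
    proof (rule C_on_linear_family_apply[OF assms(1)])
      show "linear (frechet_derivative f (at (g x)))" if "x \<in> S" for x
        using f[OF that] by (rule has_derivative_linear)
      show "C_on k S (\<lambda>x. frechet_derivative f (at (g x)) b)" for b
        using Suc.prems by (intro Suc.IH C_on_SucD[OF Suc.prems(2)]) auto
    qed (use Suc.prems(2) in auto)
  qed
qed

section \<open>Bump functions\<close>

text \<open>The functions $P(1/t)\, e^{-1/t}$, extended by \<open>0\<close> to $t \le 0$. Allowing a polynomial factor makes
  the family closed under differentiation.\<close>
definition flat_poly :: "real poly \<Rightarrow> real \<Rightarrow> real" where
  "flat_poly P t = (if t > 0 then poly P (1 / t) * exp (- (1 / t)) else 0)"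

lemma tendsto_flat_poly_0: "(flat_poly P \<longlongrightarrow> 0) (at 0)"
proof (rule filterlim_split_at)
  have "((\<lambda>_. 0) \<longlongrightarrow> (0::real)) (at_left 0)" by simp
  then show "(flat_poly P \<longlongrightarrow> 0) (at_left 0)"
    by (rule Lim_transform_eventually) (auto simp: eventually_at_filter flat_poly_def)
  \<comment> \<open>The substitution \<open>x = 1 / t\<close> turns this into $x^i / e^x \to 0$ at infinity.\<close>
  have pw: "((\<lambda>t::real. (1 / t) ^ i * exp (- (1 / t))) \<longlongrightarrow> 0) (at_right 0)" for i
    using filterlim_compose[OF tendsto_power_div_exp_0[of i] filterlim_inverse_at_top_right]
    by (simp add: exp_minus divide_inverse power_inverse)
  have "((\<lambda>t::real. \<Sum>i\<le>degree P. coeff P i * ((1 / t) ^ i * exp (- (1 / t)))) \<longlongrightarrow>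
      (\<Sum>i\<le>degree P. coeff P i * 0)) (at_right 0)"
    by (intro tendsto_sum tendsto_mult pw tendsto_const)
  then have "((\<lambda>t::real. poly P (1 / t) * exp (- (1 / t))) \<longlongrightarrow> 0) (at_right 0)"
    by (simp add: poly_altdef sum_distrib_right mult.assoc)
  then show "(flat_poly P \<longlongrightarrow> 0) (at_right 0)"
    by (rule Lim_transform_eventually) (auto simp: eventually_at_filter flat_poly_def)
qed

text \<open>For \<open>t > 0\<close> the polynomial of the derivative comes from $\frac{d}{dt} P(1/t) = - P'(1/t)/t^2$ and
  $\frac{d}{dt} e^{-1/t} = e^{-1/t}/t^2$. At \<open>0\<close> the difference quotient is again of this form, with one
  more factor $1/t$, and tends to \<open>0\<close>.\<close>
lemma flat_poly_has_derivative:
  "(flat_poly P has_real_derivative flat_poly (monom 1 2 * (P - pderiv P)) t) (at t)"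
proof -
  consider "t < 0" | "t = 0" | "t > 0" by linarith
  then show ?thesis
  proof cases
    case 1
    have "((\<lambda>_. 0) has_real_derivative 0) (at t)" by simp
    then have "(flat_poly P has_real_derivative 0) (at t)"
      by (rule has_field_derivative_transform_within_open[of _ _ _ "{..<0}"])
        (use 1 in \<open>auto simp: flat_poly_def\<close>)
    then show ?thesis using 1 by (simp add: flat_poly_def)
  next
    case 2
    have "((\<lambda>h. (flat_poly P (0 + h) - flat_poly P 0) / h) \<longlongrightarrow> 0) (at 0)"
      by (rule Lim_transform_eventually[OF tendsto_flat_poly_0[of "pCons 0 P"]])
        (auto simp: eventually_at_filter flat_poly_def)
    then show ?thesis using 2 by (simp add: DERIV_def flat_poly_def)
  next
    case 3
    have "((\<lambda>t. poly P (1 / t) * exp (- (1 / t))) has_real_derivative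
        flat_poly (monom 1 2 * (P - pderiv P)) t) (at t)"
      using 3
      by (auto intro!: derivative_eq_intros poly_DERIV[THEN DERIV_chain2]
          simp: flat_poly_def poly_monom field_simps power2_eq_square)
    then show ?thesis
      by (rule has_field_derivative_transform_within_open[of _ _ _ "{0<..}"])
        (use 3 in \<open>auto simp: flat_poly_def\<close>)
  qed
qed

lemma C_on_flat_poly: "C_on k UNIV (flat_poly P)"
proof (induction k arbitrary: P)
  case 0
  show ?case
    using flat_poly_has_derivative by (auto intro!: continuous_at_imp_continuous_on DERIV_isCont)
next
  case (Suc k)
  show ?case
  proof (rule C_on_SucI)
    show "(flat_poly P has_derivative (\<lambda>v. flat_poly (monom 1 2 * (P - pderiv P)) t * v)) (at t)" for t
      by (rule has_field_derivative_imp_has_derivative[OF flat_poly_has_derivative])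
    show "C_on k UNIV (\<lambda>t. flat_poly (monom 1 2 * (P - pderiv P)) t * v)" for v
      by (rule C_on_linear[OF open_UNIV bounded_linear_mult_left Suc.IH])
  qed simp
qed

text \<open>The function $e^{-1/t}$ is composed with \<open>t = r\<^sup>2 - \<bar>x - a\<bar>\<^sup>2\<close>, which is positive exactly inside the
  ball, and divided by its value at the centre.\<close>
lemma smooth_bump:
  fixes a :: "'e::euclidean_space"
  assumes "r > 0"
  obtains f :: "'e \<Rightarrow> real" where "smooth_on UNIV f" "f a = 1" "\<And>x. x \<notin> cball a r \<Longrightarrow> f x = 0"
proof -
  define h where "h x = flat_poly 1 (r\<^sup>2 - (x - a) \<bullet> (x - a))" for x
  have "C_on k UNIV (\<lambda>x. r\<^sup>2 - (x - a) \<bullet> (x - a))" for k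
  proof -
    have "C_on k UNIV (\<lambda>x. x - a)"
      using C_on_add[OF open_UNIV C_on_id[OF open_UNIV] C_on_const, of k "- a"] by simp
    then have "C_on k UNIV (\<lambda>x. r\<^sup>2 + (- 1) * ((x - a) \<bullet> (x - a)))"
      by (intro C_on_add C_on_const C_on_linear[OF _ bounded_linear_mult_right]
          C_on_bilinear[OF _ bounded_bilinear_inner]) auto
    then show ?thesis by simp
  qed
  then have "C_on k UNIV (\<lambda>x. inverse (h a) * h x)" for k
    unfolding h_def
    by (intro C_on_linear[OF open_UNIV bounded_linear_mult_right]
        C_on_compose[OF open_UNIV open_UNIV subset_UNIV C_on_flat_poly])
  moreover have "h a > 0" using assms by (simp add: h_def flat_poly_def)
  moreover have "h x = 0" if "x \<notin> cball a r" for x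
  proof -
    have "r\<^sup>2 \<le> (norm (x - a))\<^sup>2"
      using that assms by (intro power_mono) (auto simp: dist_norm norm_minus_commute)
    then show ?thesis by (simp add: h_def flat_poly_def dot_square_norm)
  qed
  ultimately show ?thesis
    by (intro that[of "\<lambda>x. inverse (h a) * h x"]) (auto simp: smooth_on_def)
qed

section \<open>Extending tangent vectors to vector fields\<close>

lemma smooth_on_subset: "smooth_on S f \<Longrightarrow> T \<subseteq> S \<Longrightarrow> smooth_on T f"
  by (auto simp: smooth_on_def intro: C_on_subset)

lemma smooth_on_has_derivative:
  "smooth_on S f \<Longrightarrow> x \<in> S \<Longrightarrow> (f has_derivative frechet_derivative f (at x)) (at x)"
  using C_on_Suc_derivative unfolding smooth_on_def by blast

lemma smooth_on_derivative_apply: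
  fixes u :: "'e::euclidean_space \<Rightarrow> 'e"
  assumes "open S" "smooth_on S f" "smooth_on S u"
  shows "smooth_on S (\<lambda>x. frechet_derivative f (at x) (u x))"
  unfolding smooth_on_def
proof
  fix k
  show "C_on k S (\<lambda>x. frechet_derivative f (at x) (u x))"
  proof (rule C_on_linear_family_apply[OF assms(1)])
    show "C_on k S (\<lambda>x. frechet_derivative f (at x) b)" for b
      using assms(2) unfolding smooth_on_def by (metis C_on.simps(2))
  qed (use smooth_on_has_derivative[OF assms(2)] assms(3) in
      \<open>auto simp: smooth_on_def intro: has_derivative_linear\<close>)
qed

lemma local_rep_chart_map:
  "is_chart c \<Longrightarrow> q \<in> chart_dom c \<Longrightarrow> local_rep c f (chart_map c q) = f q"
  by (simp add: is_chart_def homeomorphism_def local_rep_def)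

lemma open_chart_image:
  assumes "is_chart c" "open W"
  shows "open (chart_map c ` (chart_dom c \<inter> W))"
proof -
  have "openin (top_of_set (chart_im c)) (chart_map c ` (chart_dom c \<inter> W))"
    using assms by (intro homeomorphism_imp_open_map) (auto simp: is_chart_def openin_open_Int)
  then show ?thesis
    using assms(1) by (auto simp: is_chart_def dest: openin_open_trans)
qed

lemma transition_has_derivative:
  assumes "smooth_atlas A" "c \<in> charts_at A p" "d \<in> charts_at A p"
  shows "(local_rep c (chart_map d) has_derivative
      frechet_derivative (local_rep c (chart_map d)) (at (chart_map c p))) (at (chart_map c p))"
  using assms unfolding smooth_atlas_def charts_at_def
  by (intro smooth_on_has_derivative[of "chart_map c ` (chart_dom c \<inter> chart_dom d)"]) auto

text \<open>The cocycle rule for derivatives of transition maps, which is what makes the compatibility condition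
  in \<open>tangent_space\<close> consistent.\<close>
lemma transition_derivative_comp:
  assumes "smooth_atlas A" "c \<in> charts_at A p" "d \<in> charts_at A p" "e \<in> charts_at A p"
  shows "frechet_derivative (local_rep d (chart_map e)) (at (chart_map d p))
      (frechet_derivative (local_rep c (chart_map d)) (at (chart_map c p)) v) =
    frechet_derivative (local_rep c (chart_map e)) (at (chart_map c p)) v"
proof -
  have ch: "is_chart c" "is_chart d" and p: "p \<in> chart_dom c" "p \<in> chart_dom d"
    using assms by (auto simp: smooth_atlas_def charts_at_def)
  let ?U = "chart_map c ` (chart_dom c \<inter> chart_dom d)"
  have de: "(local_rep d (chart_map e) has_derivative
      frechet_derivative (local_rep d (chart_map e)) (at (chart_map d p)))
      (at (local_rep c (chart_map d) (chart_map c p)))"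
    using transition_has_derivative[OF assms(1,3,4)] p ch by (simp add: local_rep_chart_map)
  have "(local_rep c (chart_map e) has_derivative
      frechet_derivative (local_rep d (chart_map e)) (at (chart_map d p)) \<circ>
      frechet_derivative (local_rep c (chart_map d)) (at (chart_map c p))) (at (chart_map c p))"
  proof (rule has_derivative_transform_within_open
      [OF diff_chain_at[OF transition_has_derivative[OF assms(1,2,3)] de]])
    show "open ?U" using ch by (intro open_chart_image) (auto simp: is_chart_def)
    show "chart_map c p \<in> ?U" using p by blast
    show "(local_rep d (chart_map e) \<circ> local_rep c (chart_map d)) x = local_rep c (chart_map e) x"
      if "x \<in> ?U" for x
      using that ch by (auto simp: local_rep_chart_map)
  qed
  from frechet_derivative_at[OF this] show ?thesis by (metis comp_apply)
qed

lemma transition_derivative_linear: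
  assumes "smooth_atlas A" "c \<in> charts_at A p" "d \<in> charts_at A p"
  shows "linear (frechet_derivative (local_rep c (chart_map d)) (at (chart_map c p)))"
  by (rule has_derivative_linear[OF transition_has_derivative[OF assms]])

lemma tangent_space_component:
  "v \<in> tangent_space A p \<Longrightarrow> c \<in> charts_at A p \<Longrightarrow> d \<in> charts_at A p \<Longrightarrow>
    v d = frechet_derivative (local_rep c (chart_map d)) (at (chart_map c p)) (v c)"
  unfolding tangent_space_def by blast

lemma tangent_space_support:
  "v \<in> tangent_space A p \<Longrightarrow> c \<notin> charts_at A p \<Longrightarrow> v c = 0"
  unfolding tangent_space_def by blast

lemma tangent_spaceI:
  assumes "\<And>c. c \<notin> charts_at A p \<Longrightarrow> v c = 0"
    and "\<And>c d. c \<in> charts_at A p \<Longrightarrow> d \<in> charts_at A p \<Longrightarrow>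
      v d = frechet_derivative (local_rep c (chart_map d)) (at (chart_map c p)) (v c)"
  shows "v \<in> tangent_space A p"
  using assms unfolding tangent_space_def by blast

lemma tangent_space_add:
  assumes "smooth_atlas A" "v \<in> tangent_space A p" "w \<in> tangent_space A p"
  shows "v + w \<in> tangent_space A p"
proof (rule tangent_spaceI)
  fix c d assume cd: "c \<in> charts_at A p" "d \<in> charts_at A p"
  show "(v + w) d = frechet_derivative (local_rep c (chart_map d)) (at (chart_map c p)) ((v + w) c)"
    unfolding plus_fun_apply linear_add[OF transition_derivative_linear[OF assms(1) cd]]
      tangent_space_component[OF assms(2) cd, symmetric]
      tangent_space_component[OF assms(3) cd, symmetric] ..
qed (simp add: tangent_space_support[OF assms(2)] tangent_space_support[OF assms(3)])

lemma tangent_space_tscale: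
  assumes "smooth_atlas A" "v \<in> tangent_space A p"
  shows "tscale a v \<in> tangent_space A p"
proof (rule tangent_spaceI)
  fix c d assume cd: "c \<in> charts_at A p" "d \<in> charts_at A p"
  show "tscale a v d = frechet_derivative (local_rep c (chart_map d)) (at (chart_map c p)) (tscale a v c)"
    unfolding tscale_def linear_scale[OF transition_derivative_linear[OF assms(1) cd]]
      tangent_space_component[OF assms(2) cd, symmetric] ..
qed (simp add: tscale_def tangent_space_support[OF assms(2)])

lemma minus_tscale: "tscale (- 1) v = - v"
  by (simp add: tscale_def fun_eq_iff)

lemma tscale_zero: "tscale 0 v = 0"
  by (simp add: tscale_def fun_eq_iff)

lemma tangent_space_uminus:
  "smooth_atlas A \<Longrightarrow> v \<in> tangent_space A p \<Longrightarrow> - v \<in> tangent_space A p"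
  using tangent_space_tscale[of A v p "- 1"] by (simp add: minus_tscale)

lemma tangent_space_diff:
  "smooth_atlas A \<Longrightarrow> v \<in> tangent_space A p \<Longrightarrow> w \<in> tangent_space A p \<Longrightarrow>
    v - w \<in> tangent_space A p"
  using tangent_space_add[of A v p "- w"] tangent_space_uminus[of A w p] by simp

text \<open>The vector field with representative \<open>u\<close> in the chart \<open>c\<close>, extended by \<open>0\<close> outside the domain of \<open>c\<close>.\<close>
definition chart_lift ::
    "('a, 'e::euclidean_space) chart set \<Rightarrow> ('a, 'e) chart \<Rightarrow> ('e \<Rightarrow> 'e) \<Rightarrow> ('a, 'e) vfield" where
  "chart_lift A c u q d =
     (if c \<in> charts_at A q \<and> d \<in> charts_at A q
      then frechet_derivative (local_rep c (chart_map d)) (at (chart_map c q)) (u (chart_map c q))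
      else 0)"

lemma chart_lift_tangent:
  assumes "smooth_atlas A"
  shows "chart_lift A c u q \<in> tangent_space A q"
proof (rule tangent_spaceI)
  fix d e assume "d \<in> charts_at A q" "e \<in> charts_at A q"
  then show "chart_lift A c u q e =
      frechet_derivative (local_rep d (chart_map e)) (at (chart_map d q)) (chart_lift A c u q d)"
    using transition_derivative_comp[OF assms, of c q d e]
      linear_0[OF transition_derivative_linear[OF assms]]
    by (simp add: chart_lift_def)
qed (simp add: chart_lift_def)

text \<open>In another chart \<open>d\<close> the field is given by the transformation law over the domain of \<open>c\<close>, and it
  vanishes over the complement of the image \<open>L\<close> of \<open>K\<close> in the manifold. Both regions are open, the
  second because \<open>L\<close> is compact in a Hausdorff space, and they cover \<open>d\<close>.\<close>
lemma chart_lift_smooth: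
  assumes A: "smooth_atlas A" and c: "c \<in> A"
    and u: "smooth_on (chart_im c) u"
    and K: "compact K" "K \<subseteq> chart_im c" "\<And>x. x \<in> chart_im c - K \<Longrightarrow> u x = 0"
  shows "chart_lift A c u \<in> smooth_vfields A"
  unfolding smooth_vfields_def
proof (intro CollectI conjI allI ballI)
  show "chart_lift A c u q \<in> tangent_space A q" for q
    by (rule chart_lift_tangent[OF A])
next
  fix d assume d: "d \<in> A"
  have ch: "is_chart c" "is_chart d" using A c d by (auto simp: smooth_atlas_def)
  have doms: "open (chart_dom c)" "open (chart_dom d)" using ch by (auto simp: is_chart_def)
  let ?X = "local_rep d (\<lambda>q. chart_lift A c u q d)"
  let ?L = "inv_into (chart_dom c) (chart_map c) ` K"
  let ?V = "chart_map c ` (chart_dom c \<inter> chart_dom d)"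
  let ?U1 = "chart_map d ` (chart_dom d \<inter> chart_dom c)"
  let ?U2 = "chart_map d ` (chart_dom d \<inter> (- ?L))"
  have "compact ?L"
    using ch(1) K(1,2) unfolding is_chart_def homeomorphism_def
    by (intro compact_continuous_image) (auto elim: continuous_on_subset)
  then have "open (- ?L)" by (simp add: compact_imp_closed open_Compl)
  then have open2: "open ?U2" by (rule open_chart_image[OF ch(2)])
  have open1: "open ?U1" by (rule open_chart_image[OF ch(2) doms(1)])
  have openV: "open ?V" by (rule open_chart_image[OF ch(1) doms(2)])
  have dc: "smooth_on ?U1 (local_rep d (chart_map c))"
    and cd: "smooth_on ?V (local_rep c (chart_map d))"
    using A c d by (auto simp: smooth_atlas_def)
  have "?L \<subseteq> chart_dom c" using K(2) by (auto intro: inv_into_into)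
  then have cover: "chart_im d = ?U1 \<union> ?U2" by blast
  have "C_on k ?U1 ?X" for k
  proof (rule C_on_cong[OF open1])
    have "C_on k ?V (\<lambda>x. frechet_derivative (local_rep c (chart_map d)) (at x) (u x))"
      using smooth_on_derivative_apply[OF openV cd smooth_on_subset[OF u]]
      by (auto simp: smooth_on_def)
    moreover have "local_rep d (chart_map c) ` ?U1 \<subseteq> ?V"
      using ch by (auto simp: local_rep_chart_map)
    moreover have "C_on k ?U1 (local_rep d (chart_map c))"
      using dc by (simp add: smooth_on_def)
    ultimately show "C_on k ?U1 (\<lambda>y. frechet_derivative (local_rep c (chart_map d))
        (at (local_rep d (chart_map c) y)) (u (local_rep d (chart_map c) y)))"
      using C_on_compose[OF open1 openV] by blast
  qed (use ch c d in \<open>auto simp: local_rep_chart_map chart_lift_def charts_at_def\<close>)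
  moreover have "C_on k ?U2 ?X" for k
  proof (rule C_on_cong[OF open2 C_on_const[of _ _ 0]])
    fix y assume "y \<in> ?U2"
    then obtain q where q: "q \<in> chart_dom d" "q \<notin> ?L" "y = chart_map d q" by blast
    have "u (chart_map c q) = 0" if "q \<in> chart_dom c"
    proof (rule K(3))
      have "inv_into (chart_dom c) (chart_map c) (chart_map c q) = q"
        using ch(1) that by (simp add: is_chart_def homeomorphism_def)
      then show "chart_map c q \<in> chart_im c - K" using that q(2) by (metis DiffI imageI)
    qed
    then show "0 = ?X y"
      using q ch linear_0[OF transition_derivative_linear[OF A]]
      by (auto simp: local_rep_chart_map chart_lift_def charts_at_def)
  qed
  ultimately show "smooth_on (chart_im d) ?X"
    unfolding cover smooth_on_def by (blast intro: C_on_Un[OF open1 open2])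
qed

text \<open>The field is the lift of a bump function times the constant vector \<open>w c\<close>, where \<open>c\<close> is a chart around
  \<open>p\<close>. Tangent vectors being determined by one component, its value at \<open>p\<close> is \<open>w\<close>.\<close>
lemma tangent_vector_extends:
  assumes A: "smooth_atlas A" and w: "w \<in> tangent_space A p"
  obtains X where "X \<in> smooth_vfields A" "X p = w"
proof -
  obtain c where c: "c \<in> A" "p \<in> chart_dom c"
    using A unfolding smooth_atlas_def by blast
  then have cp: "c \<in> charts_at A p" by (simp add: charts_at_def)
  have "open (chart_im c)" "chart_map c p \<in> chart_im c"
    using A c by (auto simp: smooth_atlas_def is_chart_def)
  then obtain r where r: "r > 0" "cball (chart_map c p) r \<subseteq> chart_im c"
    by (meson open_contains_cball)
  obtain f :: "'b \<Rightarrow> real" where f: "smooth_on UNIV f" "f (chart_map c p) = 1"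
      "\<And>x. x \<notin> cball (chart_map c p) r \<Longrightarrow> f x = 0"
    using smooth_bump[OF r(1), of "chart_map c p"] by blast
  let ?u = "\<lambda>x. f x *\<^sub>R w c"
  have "smooth_on UNIV ?u"
    using f(1) unfolding smooth_on_def
    by (blast intro: C_on_linear[OF open_UNIV bounded_linear_scaleR_left])
  then have "chart_lift A c ?u \<in> smooth_vfields A"
    by (intro chart_lift_smooth[OF A c(1) smooth_on_subset compact_cball r(2)]) (auto simp: f(3))
  moreover have "chart_lift A c ?u p = w"
  proof
    show "chart_lift A c ?u p d = w d" for d
      using tangent_space_component[OF w cp, of d] tangent_space_support[OF w, of d] cp f(2)
      by (simp add: chart_lift_def)
  qed
  ultimately show ?thesis by (rule that)
qed

lemma smooth_vfield_tangent: "X \<in> smooth_vfields A \<Longrightarrow> X p \<in> tangent_space A p"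
  by (simp add: smooth_vfields_def)

section \<open>Conjugate connections of a nondegenerate symmetric form\<close>

text \<open>The clause of \<open>pseudo_riemannian_metric\<close> that allows a tangent vector to be recovered from its
  pairings.\<close>
definition nondegenerate_form ::
    "('a, 'e::euclidean_space) chart set \<Rightarrow> ('a, 'e) form_field \<Rightarrow> bool" where
  "nondegenerate_form A h \<longleftrightarrow>
     (\<forall>p. \<forall>v\<in>tangent_space A p. (\<forall>w\<in>tangent_space A p. h p v w = 0) \<longrightarrow> v = 0)"

lemma linear_connection_smooth:
  "linear_connection A D \<Longrightarrow> X \<in> smooth_vfields A \<Longrightarrow> Y \<in> smooth_vfields A \<Longrightarrow>
    D X Y \<in> smooth_vfields A"
  unfolding linear_connection_def by blast

lemma symmetric_form_add:
  "smooth_symmetric_form_field A h \<Longrightarrow> u \<in> tangent_space A p \<Longrightarrow> v \<in> tangent_space A p \<Longrightarrow>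
    w \<in> tangent_space A p \<Longrightarrow> h p (u + v) w = h p u w + h p v w"
  unfolding smooth_symmetric_form_field_def by blast

lemma symmetric_form_tscale:
  "smooth_symmetric_form_field A h \<Longrightarrow> v \<in> tangent_space A p \<Longrightarrow> w \<in> tangent_space A p \<Longrightarrow>
    h p (tscale a v) w = a * h p v w"
  unfolding smooth_symmetric_form_field_def by blast

lemma symmetric_form_commute:
  "smooth_symmetric_form_field A h \<Longrightarrow> v \<in> tangent_space A p \<Longrightarrow> w \<in> tangent_space A p \<Longrightarrow>
    h p v w = h p w v"
  unfolding smooth_symmetric_form_field_def by blast

lemma symmetric_form_uminus_right:
  assumes "smooth_symmetric_form_field A h" "smooth_atlas A"
    and v: "v \<in> tangent_space A p" and w: "w \<in> tangent_space A p"
  shows "h p v (- w) = - h p v w"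
proof -
  have "h p v (- w) = h p (- w) v"
    by (rule symmetric_form_commute[OF assms(1) v tangent_space_uminus[OF assms(2) w]])
  also have "\<dots> = - h p w v"
    using symmetric_form_tscale[OF assms(1) w v, of "- 1"] by (simp add: minus_tscale)
  finally show ?thesis by (simp add: symmetric_form_commute[OF assms(1) v w])
qed

lemma form_app_commute:
  "smooth_symmetric_form_field A h \<Longrightarrow> X \<in> smooth_vfields A \<Longrightarrow> Y \<in> smooth_vfields A \<Longrightarrow>
    form_app h X Y = form_app h Y X"
  unfolding form_app_def by (intro ext symmetric_form_commute smooth_vfield_tangent)

lemma cov_deriv_form_eq_difference:
  assumes "conjugate_connection A h D D'"
    and "X \<in> smooth_vfields A" "Y \<in> smooth_vfields A" "Z \<in> smooth_vfields A"
  shows "cov_deriv_form A D h Z X Y = form_app h X (D' Z Y) - form_app h X (D Z Y)"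
  using assms unfolding conjugate_connection_def cov_deriv_form_def by simp

lemma cov_deriv_form_commute:
  assumes "smooth_symmetric_form_field A h" "linear_connection A D"
    and "X \<in> smooth_vfields A" "Y \<in> smooth_vfields A" "Z \<in> smooth_vfields A"
  shows "cov_deriv_form A D h Z X Y = cov_deriv_form A D h Z Y X"
  using form_app_commute[OF assms(1)] linear_connection_smooth[OF assms(2)] assms(3-)
  by (simp add: cov_deriv_form_def algebra_simps)

text \<open>Conjugacy trades one of the two correction terms of the covariant derivative for the derivative of the
  function \<open>h(X,Y)\<close>: for \<open>D\<close> this leaves the difference of \<open>D'\<close> and \<open>D\<close> in the second slot, for \<open>D'\<close> the
  opposite difference in the first. The symmetry of \<open>h\<close> exchanges the slots.\<close>
lemma cov_deriv_form_conjugate: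
  assumes h: "smooth_symmetric_form_field A h" and D: "linear_connection A D"
    and conj: "conjugate_connection A h D D'"
    and X: "X \<in> smooth_vfields A" and Y: "Y \<in> smooth_vfields A" and Z: "Z \<in> smooth_vfields A"
  shows "cov_deriv_form A D' h Z X Y = - cov_deriv_form A D h Z X Y"
proof -
  have D': "linear_connection A D'" using conj by (simp add: conjugate_connection_def)
  have "cov_deriv_form A D' h Z X Y = form_app h (D Z X) Y - form_app h (D' Z X) Y"
    using conj X Y Z by (simp add: conjugate_connection_def cov_deriv_form_def)
  also have "\<dots> = form_app h Y (D Z X) - form_app h Y (D' Z X)"
    using form_app_commute[OF h _ Y] linear_connection_smooth[OF D Z X]
      linear_connection_smooth[OF D' Z X] by simp
  also have "\<dots> = - cov_deriv_form A D h Z Y X"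
    by (simp add: cov_deriv_form_eq_difference[OF conj Y X Z])
  also have "\<dots> = - cov_deriv_form A D h Z X Y"
    by (simp add: cov_deriv_form_commute[OF h D X Y Z])
  finally show ?thesis .
qed

lemma codazzi_pair_conjugate_iff:
  assumes "smooth_symmetric_form_field A h" "linear_connection A D" "conjugate_connection A h D D'"
  shows "codazzi_pair A D' h \<longleftrightarrow> codazzi_pair A D h"
  unfolding codazzi_pair_def using cov_deriv_form_conjugate[OF assms] by simp

text \<open>The Codazzi condition makes $D h$ symmetric in its first two arguments, and it is always symmetric
  in the last two, hence it is totally symmetric. Since $(D_X h)(W,Y) = h(W, D'_X Y - D_X Y)$, the
  difference of the two connections is symmetric, so they have the same torsion.\<close>
lemma codazzi_imp_conjugate_torsion_free:
  assumes A: "smooth_atlas A"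
    and h: "smooth_symmetric_form_field A h" "nondegenerate_form A h"
    and D: "linear_connection A D" "torsion_free A D" "codazzi_pair A D h"
    and conj: "conjugate_connection A h D D'"
  shows "torsion_free A D'"
  unfolding torsion_free_def
proof (intro ballI)
  fix X Y assume X: "X \<in> smooth_vfields A" and Y: "Y \<in> smooth_vfields A"
  have D': "linear_connection A D'" using conj by (simp add: conjugate_connection_def)
  note smooth = linear_connection_smooth[OF D(1) X Y] linear_connection_smooth[OF D(1) Y X]
    linear_connection_smooth[OF D' X Y] linear_connection_smooth[OF D' Y X]
  note add = symmetric_form_add[OF h(1)]
  \<comment> \<open>Symmetry of \<open>D' - D\<close>, with the terms regrouped to avoid differences.\<close>
  have "D' X Y p + D Y X p = D' Y X p + D X Y p" for p
  proof -
    let ?v = "D' X Y p + D Y X p" and ?w = "D' Y X p + D X Y p"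
    note tan = smooth[THEN smooth_vfield_tangent, of p]
    have vw: "?v \<in> tangent_space A p" "?w \<in> tangent_space A p"
      using tan by (auto intro: tangent_space_add[OF A])
    have "h p (?v - ?w) u = 0" if u: "u \<in> tangent_space A p" for u
    proof -
      obtain W where W: "W \<in> smooth_vfields A" "W p = u"
        using tangent_vector_extends[OF A u] .
      \<comment> \<open>Total symmetry: \<open>(X, W, Y)\<close> is permuted to \<open>(W, X, Y)\<close>, \<open>(W, Y, X)\<close> and \<open>(Y, W, X)\<close>.\<close>
      have "cov_deriv_form A D h X W Y = cov_deriv_form A D h W Y X"
        using D(3) W(1) X Y cov_deriv_form_commute[OF h(1) D(1)] by (metis codazzi_pair_def)
      also have "\<dots> = cov_deriv_form A D h Y W X"
        using D(3) W(1) X Y by (metis codazzi_pair_def)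
      finally have "form_app h (D' X Y) W - form_app h (D X Y) W =
          form_app h (D' Y X) W - form_app h (D Y X) W"
        using cov_deriv_form_eq_difference[OF conj W(1)] X Y
          form_app_commute[OF h(1) W(1)] smooth by simp
      from fun_cong[OF this, of p] have "h p ?v u = h p ?w u"
        using add tan u by (simp add: form_app_def W(2))
      moreover have "h p (?v - ?w) u + h p ?w u = h p ?v u"
        using add[OF tangent_space_diff[OF A vw] vw(2) u] by simp
      ultimately show ?thesis by simp
    qed
    then have "?v - ?w = 0"
      using h(2) tangent_space_diff[OF A vw] unfolding nondegenerate_form_def by blast
    then show ?thesis by simp
  qed
  then have "D' X Y + D Y X = D' Y X + D X Y" by (auto simp: fun_eq_iff)
  then have "D' X Y - D' Y X = D X Y - D Y X" by (simp add: algebra_simps)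
  then show "D' X Y - D' Y X = lie_bracket A X Y"
    using D(2) X Y by (simp add: torsion_free_def)
qed

lemma statistical_structure_conjugate_iff:
  assumes "smooth_atlas A" "smooth_symmetric_form_field A h" "nondegenerate_form A h"
    and "linear_connection A D" "torsion_free A D" "conjugate_connection A h D D'"
  shows "statistical_structure A D h \<longleftrightarrow> statistical_structure A D' h"
  using codazzi_pair_conjugate_iff codazzi_imp_conjugate_torsion_free assms
  unfolding statistical_structure_def by blast

section \<open>The twin metric\<close>

context
  fixes A :: "('a::{t2_space,second_countable_topology}, 'e::euclidean_space) chart set"
    and n :: nat and J :: "('a, 'e) endo_field" and g G :: "('a, 'e) form_field"
  assumes aah: "almost_anti_hermitian A n J g G"
begin

lemma aah_atlas: "smooth_atlas A"
  and aah_metric: "smooth_symmetric_form_field A g" "nondegenerate_form A g"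
  and aah_endo: "smooth_endo_field A J"
  using aah by (auto simp: almost_anti_hermitian_def pseudo_riemannian_metric_def
      nondegenerate_form_def almost_complex_structure_def)

lemma J_square: "v \<in> tangent_space A p \<Longrightarrow> J p (J p v) = - v"
  using aah by (simp add: almost_anti_hermitian_def almost_complex_structure_def)

lemma J_tangent: "v \<in> tangent_space A p \<Longrightarrow> J p v \<in> tangent_space A p"
  using aah_endo by (simp add: smooth_endo_field_def)

lemma J_smooth: "X \<in> smooth_vfields A \<Longrightarrow> endo_app J X \<in> smooth_vfields A"
  using aah_endo by (simp add: smooth_endo_field_def)

lemma twin_eq:
  "v \<in> tangent_space A p \<Longrightarrow> w \<in> tangent_space A p \<Longrightarrow> G p v w = g p (J p v) w"
  using aah by (simp add: almost_anti_hermitian_def)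

lemma twin_app:
  "X \<in> smooth_vfields A \<Longrightarrow> Y \<in> smooth_vfields A \<Longrightarrow> form_app G X Y = form_app g (endo_app J X) Y"
  by (auto simp: form_app_def endo_app_def fun_eq_iff intro: twin_eq smooth_vfield_tangent)

text \<open>The condition \<open>g(J X, J Y) = - g(X, Y)\<close> is given for vector fields; extending \<open>v\<close> and \<open>J w\<close> to
  fields brings it to a point, where $J(J w) = - w$.\<close>
lemma J_self_adjoint:
  assumes v: "v \<in> tangent_space A p" and w: "w \<in> tangent_space A p"
  shows "g p (J p v) w = g p v (J p w)"
proof -
  obtain X where X: "X \<in> smooth_vfields A" "X p = v" using tangent_vector_extends[OF aah_atlas v] .
  obtain Y where Y: "Y \<in> smooth_vfields A" "Y p = J p w"
    using tangent_vector_extends[OF aah_atlas J_tangent[OF w]] .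
  have "form_app g (endo_app J X) (endo_app J Y) = - form_app g X Y"
    using aah X(1) Y(1) by (simp add: almost_anti_hermitian_def)
  from fun_cong[OF this, of p] have "g p (J p v) (- w) = - g p v (J p w)"
    by (simp add: form_app_def endo_app_def X(2) Y(2) J_square[OF w])
  moreover have "g p (J p v) (- w) = - g p (J p v) w"
    by (rule symmetric_form_uminus_right[OF aah_metric(1) aah_atlas J_tangent[OF v] w])
  ultimately show ?thesis by simp
qed

lemma twin_symmetric_form: "smooth_symmetric_form_field A G"
  unfolding smooth_symmetric_form_field_def
proof (intro conjI allI ballI)
  fix p u v w
  assume T: "u \<in> tangent_space A p" "v \<in> tangent_space A p" "w \<in> tangent_space A p"
  have "J p (u + v) = J p u + J p v"
    using aah_endo T unfolding smooth_endo_field_def by blast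
  then show "G p (u + v) w = G p u w + G p v w"
    using T by (simp add: twin_eq tangent_space_add[OF aah_atlas] symmetric_form_add[OF aah_metric(1)]
        J_tangent)
next
  fix p a v w assume T: "v \<in> tangent_space A p" "w \<in> tangent_space A p"
  have "J p (tscale a v) = tscale a (J p v)"
    using aah_endo T unfolding smooth_endo_field_def by blast
  then show "G p (tscale a v) w = a * G p v w"
    using T by (simp add: twin_eq tangent_space_tscale[OF aah_atlas]
        symmetric_form_tscale[OF aah_metric(1)] J_tangent)
next
  fix p v w assume T: "v \<in> tangent_space A p" "w \<in> tangent_space A p"
  have "g p v (J p w) = g p (J p w) v"
    by (rule symmetric_form_commute[OF aah_metric(1) T(1) J_tangent[OF T(2)]])
  then show "G p v w = G p w v"
    using T by (simp add: twin_eq J_self_adjoint)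
next
  fix X Y assume "X \<in> smooth_vfields A" "Y \<in> smooth_vfields A"
  then show "smooth_fun A (form_app G X Y)"
    using aah_metric(1) J_smooth by (simp add: twin_app smooth_symmetric_form_field_def)
qed

text \<open>A vector in the kernel of \<open>G\<close> is mapped by \<open>J\<close> into the kernel of \<open>g\<close>, and \<open>J\<close> is injective.\<close>
lemma twin_nondegenerate: "nondegenerate_form A G"
  unfolding nondegenerate_form_def
proof (intro allI ballI impI)
  fix p v assume v: "v \<in> tangent_space A p" and 0: "\<forall>w\<in>tangent_space A p. G p v w = 0"
  then have "J p v = 0"
    using aah_metric(2) J_tangent[OF v] by (simp add: nondegenerate_form_def twin_eq)
  moreover have "J p (tscale 0 v) = tscale 0 (J p v)"
    using aah_endo v unfolding smooth_endo_field_def by blast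
  ultimately have "J p (J p v) = 0" by (simp add: tscale_zero)
  then show "v = 0" using J_square[OF v] by simp
qed

text \<open>Since \<open>D\<close> commutes with \<open>J\<close>, applying conjugacy with respect to \<open>g\<close> to the fields \<open>J X\<close> and \<open>Y\<close> gives
  \<open>Z G(X, Y) = g(D\<^sub>Z (J X), Y) + g(J X, D'\<^sub>Z Y) = G(D\<^sub>Z X, Y) + G(X, D'\<^sub>Z Y)\<close>.\<close>
lemma twin_conjugate:
  assumes D: "linear_connection A D" "J_invariant A J D" and conj: "conjugate_connection A g D D'"
  shows "conjugate_connection A G D D'"
  using assms J_smooth linear_connection_smooth[OF D(1)]
  by (simp add: conjugate_connection_def J_invariant_def twin_app linear_connection_smooth)

end

theorem theorem5:
  fixes A :: "('a::{t2_space,second_countable_topology}, 'e::euclidean_space) chart set"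
    and n :: nat
    and J :: "('a, 'e) endo_field"
    and g G :: "('a, 'e) form_field"
    and nabla nabla_conj :: "('a, 'e) connection"
  assumes "almost_anti_hermitian A n J g G"
    and "linear_connection A nabla"
    and "J_invariant A J nabla"
    and "torsion_free A nabla"
    and "conjugate_connection A g nabla nabla_conj"
  shows "statistical_structure A nabla G \<longleftrightarrow> statistical_structure A nabla_conj G"
  using statistical_structure_conjugate_iff[OF aah_atlas[OF assms(1)] twin_symmetric_form[OF assms(1)]
      twin_nondegenerate[OF assms(1)] assms(2,4) twin_conjugate[OF assms(1,2,3,5)]] .

end
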